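(* Given any function $t:\mathbb{N}\to\mathbb{R}$, there is a function $r:\mathbb{N}\to[0,\infty)$ with $t(n)=o(r(n))$ as $n\to\infty$, such that no automorphism $T$ constructed with the $\mathbb{F}$-method satisfies \[\lim_{n\to\infty}\frac{\log F_n(T)}{r(n)}=1.\]
   Context: $\mathbb{N}$ denotes the positive integers. The notation $f(n)=o(g(n))$ means $f(n)/g(n)\to 0$ as $n\to\infty$. For an automorphism $T$ of a compact group $G$ and $n\in\mathbb{N}$, $F_n(T):=\#\{g\in G: T^n g=g\}$. The $\mathbb{F}$-method: consider sequences of pairs of integers $\{(p_n,g_n)\}_{n=1}^{\infty}$ such that (i) each $p_n$ is either prime or equal to $1$, and $p_1=1$; (ii) each $p_n$ satisfies $p_n\equiv 1 \pmod n$; (iii) if $p_n=1$ then $g_n=0$, otherwise $g_n$ is a primitive root modulo $p_n$. To such a sequence the $\mathbb{F}$-method associates the pair $(G,T)$, where $G=\prod_{n=1}^{\infty}\mathbb{F}_{p_n}$ is the direct product (with the product topology) of the additive groups of the finite fields $\mathbb{F}_{p_n}$, each with the discrete topology (with the convention that $\mathbb{F}_{1}$ is the group with one element), and $T(x_1,x_2,\ldots)=(T_1(x_1),T_2(x_2),\ldots)$, where $T_n:\mathbb{F}_{p_n}\to\mathbb{F}_{p_n}$ is the trivial automorphism when $p_n=1$ and is otherwise defined by $T_n(x_n)=g_n^{(p_n-1)/n}x_n$. An automorphism $T$ is said to be constructed with the $\mathbb{F}$-method if $(G,T)$ arises in this way from some such sequence. *)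

theory Defs
  imports
    "HOL-Analysis.Analysis"
    "HOL-Algebra.Product_Groups"
    "HOL-Number_Theory.Number_Theory"
begin

text \<open>
  The positive integers are rendered as the indices \<open>n \<ge> 1\<close> of type \<open>nat\<close>;
  values at index \<open>0\<close> are never used.
\<close>

text \<open>
  \<open>f n / g n\<close> tends to \<open>0\<close>, where the quotient has to be meaningful for all large \<open>n\<close>.
  The first conjunct is needed because division by zero yields \<open>0\<close> in HOL: without it the
  zero function would dominate every function.
\<close>
definition little_o_seq :: "(nat \<Rightarrow> real) \<Rightarrow> (nat \<Rightarrow> real) \<Rightarrow> bool" where
  "little_o_seq f g \<longleftrightarrow>
     (\<forall>\<^sub>F n in sequentially. g n \<noteq> 0) \<and> (\<lambda>n. f n / g n) \<longlonglongrightarrow> 0"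

text \<open>
  The count is meant for maps with finitely many fixed points (\<open>card\<close> of an infinite set
  is \<open>0\<close>). For \<open>T\<close> coming from the \<open>\<F>\<close>-method the set is always finite: the \<open>k\<close>-th
  coordinate of a fixed point of \<open>T ^^ n\<close> vanishes unless \<open>k\<close> divides \<open>n\<close>.
\<close>
definition num_periodic :: "('a, 'm) monoid_scheme \<Rightarrow> nat \<Rightarrow> ('a \<Rightarrow> 'a) \<Rightarrow> nat" where
  "num_periodic G n T = card {x \<in> carrier G. (T ^^ n) x = x}"

text \<open>
  The library predicate \<open>residue_primroot\<close> takes natural numbers, so an arbitrary
  integer \<open>g\<close> is replaced by its least nonnegative residue.
\<close>
definition primitive_root_mod :: "int \<Rightarrow> int \<Rightarrow> bool" where
  "primitive_root_mod p g \<longleftrightarrow> residue_primroot (nat p) (nat (g mod p))"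

definition F_sequence :: "(nat \<Rightarrow> int) \<Rightarrow> (nat \<Rightarrow> int) \<Rightarrow> bool" where
  "F_sequence p g \<longleftrightarrow>
     p 1 = 1 \<and>
     (\<forall>n\<ge>1. (prime (p n) \<or> p n = 1) \<and>
            [p n = 1] (mod int n) \<and>
            (if p n = 1 then g n = 0 else primitive_root_mod (p n) (g n)))"

text \<open>
  \<open>residue_ring 1\<close> is not a ring, but its additive group is the one-element group
  \<open>{0}\<close>, which is the convention for \<open>p n = 1\<close>.
\<close>
definition F_group :: "(nat \<Rightarrow> int) \<Rightarrow> (nat \<Rightarrow> int) monoid" where
  "F_group p = product_group {1..} (\<lambda>n. add_monoid (residue_ring (p n)))"

definition F_topology :: "(nat \<Rightarrow> int) \<Rightarrow> (nat \<Rightarrow> int) topology" where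
  "F_topology p =
     product_topology (\<lambda>n. discrete_topology (carrier (residue_ring (p n)))) {1..}"

definition F_component :: "(nat \<Rightarrow> int) \<Rightarrow> (nat \<Rightarrow> int) \<Rightarrow> nat \<Rightarrow> int \<Rightarrow> int" where
  "F_component p g n x =
     (if p n = 1 then x else (g n ^ nat ((p n - 1) div int n) * x) mod p n)"

definition F_map :: "(nat \<Rightarrow> int) \<Rightarrow> (nat \<Rightarrow> int) \<Rightarrow> (nat \<Rightarrow> int) \<Rightarrow> (nat \<Rightarrow> int)" where
  "F_map p g = (\<lambda>x\<in>carrier (F_group p). \<lambda>n\<in>{1..}. F_component p g n (x n))"

text \<open>
  The compact group is given by its group structure \<open>G\<close> together with its topology \<open>X\<close>
  on \<open>carrier G\<close>.
\<close>
definition F_method ::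
  "(nat \<Rightarrow> int) monoid \<Rightarrow> (nat \<Rightarrow> int) topology \<Rightarrow> ((nat \<Rightarrow> int) \<Rightarrow> (nat \<Rightarrow> int)) \<Rightarrow> bool" where
  "F_method G X T \<longleftrightarrow>
     (\<exists>p g. F_sequence p g \<and> G = F_group p \<and> X = F_topology p \<and> T = F_map p g)"

end

theory Submission
  imports Defs
begin

text \<open>
  The obstruction is monotonicity along divisibility: every point fixed by \<open>T ^^ n\<close> is fixed
  by \<open>T ^^ m\<close> whenever \<open>n\<close> divides \<open>m\<close>, so \<open>F\<^sub>n(T) \<le> F\<^sub>m(T)\<close> as soon as the larger set is finite
  (\<open>num_periodic_mono\<close>). A function \<open>r\<close> that exceeds \<open>t\<close> as much as required may nevertheless
  drop by a factor of at least \<open>2\<close> from each odd \<open>n\<close> to \<open>2 * n\<close>: starting from any positive \<open>s\<close>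
  with \<open>t(n) = o(s(n))\<close>, put \<open>r n = s n\<close> for even \<open>n\<close>, and \<open>r n = s n + 2 * s (2 * n)\<close> for odd
  \<open>n\<close>. If \<open>ln F\<^sub>n(T)\<close> were asymptotic to \<open>r n\<close>, then for large odd \<open>n\<close> it would also drop from
  \<open>n\<close> to \<open>2 * n\<close>, contradicting monotonicity.

  Finiteness of the sets of periodic points also comes from the assumed asymptotics: an infinite
  set has cardinality \<open>0\<close> by default, and the logarithm of \<open>0\<close> is \<open>0\<close> by default, so the
  quotient by \<open>r n\<close> would be \<open>0\<close> rather than close to \<open>1\<close>.
\<close>

lemma num_periodic_mono:
  assumes "n dvd m" and "num_periodic G m T > 0"
  shows "num_periodic G n T \<le> num_periodic G m T"
proof -
  from \<open>n dvd m\<close> obtain k where m: "m = n * k" ..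
  have "(T ^^ m) x = x" if "(T ^^ n) x = x" for x
  proof -
    have "((T ^^ n) ^^ k) x = x"
      by (induction k) (simp_all add: that)
    then show ?thesis
      by (simp add: m funpow_mult mult.commute)
  qed
  then have "{x \<in> carrier G. (T ^^ n) x = x} \<subseteq> {x \<in> carrier G. (T ^^ m) x = x}"
    by blast
  then show ?thesis
    \<comment> \<open>A positive \<open>card\<close> certifies that the larger set is finite.\<close>
    using assms(2) unfolding num_periodic_def by (intro card_mono) (auto intro: card_ge_0_finite)
qed

lemma not_asymptotic_if_drops:
  fixes r :: "nat \<Rightarrow> real"
  assumes pos: "\<And>n. n \<ge> 1 \<Longrightarrow> r n > 0"
    and drop: "\<And>n. odd n \<Longrightarrow> r n \<ge> 2 * r (2 * n)"
  shows "\<not> (\<lambda>n. ln (real (num_periodic G n T)) / r n) \<longlonglongrightarrow> 1"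
proof
  define f where "f n = ln (real (num_periodic G n T))" for n
  assume "(\<lambda>n. ln (real (num_periodic G n T)) / r n) \<longlonglongrightarrow> 1"
  then have lim: "(\<lambda>n. f n / r n) \<longlonglongrightarrow> 1"
    by (simp add: f_def)
  \<comment> \<open>Any two bounds around \<open>1\<close> whose ratio is less than \<open>2\<close> serve here.\<close>
  have "\<forall>\<^sub>F n in sequentially. 3/4 < f n / r n \<and> f n / r n < 5/4"
    by (intro eventually_conj order_tendstoD[OF lim]) simp_all
  then obtain N where N: "\<And>n. n \<ge> N \<Longrightarrow> 3/4 < f n / r n \<and> f n / r n < 5/4"
    unfolding eventually_sequentially by blast
  define n where "n = 2 * N + 1"
  have r: "r n > 0" "r (2 * n) > 0" "r n \<ge> 2 * r (2 * n)"
    using pos[of n] pos[of "2 * n"] drop[of n] by (auto simp: n_def)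
  have lower: "3/4 * r n < f n" "3/4 * r (2 * n) < f (2 * n)"
    using N[of n] N[of "2 * n"] r by (simp_all add: n_def field_simps)
  have upper: "f (2 * n) < 5/4 * r (2 * n)"
    using N[of "2 * n"] r by (simp add: n_def field_simps)
  have "f n \<noteq> 0" "f (2 * n) \<noteq> 0"
    using lower r by auto
  then have card_pos: "num_periodic G n T > 0" "num_periodic G (2 * n) T > 0"
    unfolding f_def by (auto intro: gr0I)
  then have "f n \<le> f (2 * n)"
    using num_periodic_mono[of n "2 * n" G T] by (simp add: f_def)
  with lower upper r show False
    by linarith
qed

theorem theorem1p3:
  fixes t :: "nat \<Rightarrow> real"
  shows "\<exists>r :: nat \<Rightarrow> real.
    (\<forall>n\<ge>1. r n \<ge> 0) \<and>
    little_o_seq t r \<and>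
    \<not> (\<exists>G X T. F_method G X T \<and>
          (\<lambda>n. ln (real (num_periodic G n T)) / r n) \<longlonglongrightarrow> 1)"
proof -
  define s where "s n = real n * (\<bar>t n\<bar> + 1)" for n
  define r where "r n = (if odd n then s n + 2 * s (2 * n) else s n)" for n
  have s_nonneg: "s n \<ge> 0" for n
    by (simp add: s_def)
  have s_le_r: "s n \<le> r n" for n
    using s_nonneg[of "2 * n"] by (simp add: r_def)
  have s_pos: "s n > 0" if "n \<ge> 1" for n
    using that by (simp add: s_def add_nonneg_pos)
  have r_pos: "r n > 0" if "n \<ge> 1" for n
    using s_pos[OF that] s_le_r[of n] by linarith
  have drop: "r n \<ge> 2 * r (2 * n)" if "odd n" for n
    using that s_nonneg[of n] by (simp add: r_def)
  have bound: "norm (t n / r n) \<le> 1 / real n" if "n \<ge> 1" for n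
  proof -
    have "real n * \<bar>t n\<bar> \<le> s n"
      by (simp add: s_def algebra_simps)
    also note s_le_r
    finally show ?thesis
      using that r_pos[OF that] by (simp add: abs_divide field_simps)
  qed
  have "(\<lambda>n. t n / r n) \<longlonglongrightarrow> 0"
    by (rule Lim_null_comparison[OF _ lim_1_over_n])
      (use bound in \<open>auto simp: eventually_sequentially intro!: exI[of _ 1]\<close>)
  moreover have "\<forall>\<^sub>F n in sequentially. r n \<noteq> 0"
    unfolding eventually_sequentially by (metis r_pos less_irrefl)
  ultimately have "little_o_seq t r"
    by (simp add: little_o_seq_def)
  moreover have "\<forall>n\<ge>1. r n \<ge> 0"
    using r_pos by (simp add: less_imp_le)
  ultimately show ?thesis
    using not_asymptotic_if_drops[of r, OF r_pos drop] by blast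
qed

end
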